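(* Let $K$ be a field of characteristic not equal to $2$ or $3$, let $K'$ be an algebraic closure of $K$, let $\zeta$ be a primitive cube root of unity in $K'$, and assume $\zeta \notin K$. Let $f(x) = x^3+Ax+B \in K[x]$ with $B \neq 0$, and let $\Delta = B^2+4A^3/27$. If $A=0$, let $C=-B$, and if $A\neq 0$, let $C$ be either square root of $\Delta$ in $K'$. Then $f$ splits completely over $K$ if and only if (a) $\Delta$ is a square in $K(\zeta)$ and not a square in $K$, and (b) $\frac{-B+C}{2}$ is a cube in $K(\zeta)$ and not a cube in $K$.
   Formalization: "Splits completely over K" is taken to mean a product of pairwise distinct linear factors over K; with repeated factors allowed the claim fails exactly when Δ = 0, e.g. x^3-3x+2 = (x-1)^2(x+2) over Q, and for Δ ≠ 0 the two meanings agree. *)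

theory Defs
  imports "HOL-Computational_Algebra.Computational_Algebra"
begin

text \<open>
  The base field is a type \<open>'a :: field\<close>; an algebraic closure of it is an algebraically closed
  field \<open>'b\<close> together with a field homomorphism from \<open>'a\<close> over which \<open>'b\<close> is algebraic. The base
  field, viewed inside the closure, is \<open>range \<iota>\<close>.
\<close>

locale field_algebraic_closure =
  fixes \<iota> :: "'a :: field \<Rightarrow> 'b :: alg_closed_field"
  assumes emb_one: "\<iota> 1 = 1"
    and emb_add: "\<iota> (x + y) = \<iota> x + \<iota> y"
    and emb_mult: "\<iota> (x * y) = \<iota> x * \<iota> y"
    and algebraic: "\<exists>p. p \<noteq> 0 \<and> poly (map_poly \<iota> p) z = 0"

definition is_subfield :: "'b :: field set \<Rightarrow> bool" where
  "is_subfield F \<longleftrightarrow> 1 \<in> F \<and> (\<forall>x\<in>F. \<forall>y\<in>F. x - y \<in> F \<and> x * y \<in> F) \<and> (\<forall>x\<in>F. inverse x \<in> F)"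

definition adjoin :: "'b :: field set \<Rightarrow> 'b \<Rightarrow> 'b set" where
  "adjoin F z = \<Inter>{E. is_subfield E \<and> F \<subseteq> E \<and> z \<in> E}"

definition primitive_root_of_unity :: "nat \<Rightarrow> 'b :: field \<Rightarrow> bool" where
  "primitive_root_of_unity n z \<longleftrightarrow> 0 < n \<and> z ^ n = 1 \<and> (\<forall>m. 0 < m \<and> m < n \<longrightarrow> z ^ m \<noteq> 1)"

definition square_in :: "'b :: field set \<Rightarrow> 'b \<Rightarrow> bool" where
  "square_in F x \<longleftrightarrow> (\<exists>y\<in>F. x = y ^ 2)"

definition cube_in :: "'b :: field set \<Rightarrow> 'b \<Rightarrow> bool" where
  "cube_in F x \<longleftrightarrow> (\<exists>y\<in>F. x = y ^ 3)"

text \<open>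
  A polynomial splits completely over \<open>'a\<close> if it is, up to its leading coefficient, a product of
  \<^emph>\<open>pairwise distinct\<close> monic linear factors over \<open>'a\<close>. Distinctness matters only for polynomials
  with a repeated root: \<open>x^3 - 3 x + 2 = (x - 1)^2 (x + 2)\<close> over the rationals does not split
  completely in this sense. Its \<open>B^2 + 4 A^3 / 27\<close> is \<open>0\<close>, a square in the base field.
\<close>

definition splits_completely :: "'a :: field poly \<Rightarrow> bool" where
  "splits_completely p \<longleftrightarrow> (\<exists>S. finite S \<and> p = smult (lead_coeff p) (\<Prod>a\<in>S. [:- a, 1:]))"

text \<open>
  For a cubic with nonzero \<open>B^2 + 4 A^3 / 27\<close>, this is the same as being a product of linear factors.
\<close>

lemma splits_completely_cubic_iff:
  fixes A B :: "'a :: field"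
  assumes "CHAR('a) \<noteq> 3" "B ^ 2 + 4 * A ^ 3 / 27 \<noteq> 0"
  shows "splits_completely [:B, A, 0, 1:] \<longleftrightarrow>
    (\<exists>a b c. [:B, A, 0, 1:] = [:- a, 1:] * [:- b, 1:] * [:- c, 1:])"
proof
  assume "splits_completely [:B, A, 0, 1:]"
  then obtain S where S: "finite S" "[:B, A, 0, 1:] = (\<Prod>a\<in>S. [:- a, 1:])"
    by (auto simp: splits_completely_def)
  have "degree [:B, A, 0, 1:] = card S"
    using S(1) unfolding S(2) by (subst degree_prod_eq_sum_degree) auto
  hence "card S = 3" by simp
  then obtain a b c where "S = {a, b, c}" "a \<noteq> b" "a \<noteq> c" "b \<noteq> c"
    by (auto simp: card_3_iff)
  thus "\<exists>a b c. [:B, A, 0, 1:] = [:- a, 1:] * [:- b, 1:] * [:- c, 1:]"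
    using S(2) by (intro exI[of _ a] exI[of _ b] exI[of _ c]) (simp add: mult.assoc del: mult_pCons_left mult_pCons_right)
next
  assume "\<exists>a b c. [:B, A, 0, 1:] = [:- a, 1:] * [:- b, 1:] * [:- c, 1:]"
  then obtain a b c where f: "[:B, A, 0, 1:] = [:- a, 1:] * [:- b, 1:] * [:- c, 1:]" by blast
  have three: "(3 :: 'a) \<noteq> 0"
  proof
    assume "(3 :: 'a) = 0"
    hence "CHAR('a) dvd 3"
      by (metis of_nat_eq_0_iff_char_dvd of_nat_numeral)
    moreover have "CHAR('a) \<noteq> 1" by simp
    moreover have "prime (3 :: nat)" by simp
    ultimately show False using assms(1) prime_nat_iff by blast
  qed
  have "(27 :: 'a) = 3 ^ 3" by simp
  hence tw: "(27 :: 'a) \<noteq> 0" using three by (metis power_not_zero)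
  have coeffs: "a + b + c = 0" "A = a * b + a * c + b * c" "B = - (a * b * c)"
    using f by (auto simp: algebra_simps add_eq_0_iff)
  have c: "c = - (a + b)" using coeffs(1) by (metis add_eq_0_iff)
  have disc: "- 27 * (B ^ 2 + 4 * A ^ 3 / 27) = ((a - b) * (a - c) * (b - c)) ^ 2"
  proof -
    have "- 27 * (B ^ 2 + 4 * A ^ 3 / 27) = - 27 * B ^ 2 - 4 * A ^ 3"
      using tw by (simp add: field_simps)
    also have "\<dots> = ((a - b) * (a - c) * (b - c)) ^ 2"
      unfolding coeffs(2,3) c by (simp add: algebra_simps power2_eq_square power3_eq_cube)
    finally show ?thesis .
  qed
  have "((a - b) * (a - c) * (b - c)) ^ 2 \<noteq> 0"
    unfolding disc [symmetric] using assms(2) tw by (metis mult_eq_0_iff neg_equal_0_iff_equal)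
  hence d: "a \<noteq> b" "a \<noteq> c" "b \<noteq> c" by auto
  have prod: "[:B, A, 0, 1:] = (\<Prod>x\<in>{a, b, c}. [:- x, 1:])"
    using d f by (simp add: mult.assoc del: mult_pCons_left mult_pCons_right)
  show "splits_completely [:B, A, 0, 1:]"
    unfolding splits_completely_def by (intro exI[of _ "{a, b, c}"]) (simp flip: prod)
qed

end

theory Submission
  imports Defs
begin

text \<open>
  Put \<open>s = 2 \<zeta> + 1\<close>, so that \<open>s^2 = -3\<close> and \<open>K(\<zeta>) = K + K s\<close>.
  Three roots in \<open>K\<close> with sum \<open>0\<close> can be written as \<open>2 x\<close> and \<open>-x \<plusminus> 3 y\<close>, where \<open>x + y s\<close>
  is the Lagrange resolvent \<open>(a + \<zeta> b + \<zeta>^2 c) / 3\<close>. For the right sign of \<open>y\<close>, in these coordinates \<open>A = -3 (x^2 + 3 y^2)\<close>, and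
  \<open>(-B + C) / 2 = (x + y s)^3\<close> with \<open>C = 6 y (x^2 - y^2) s\<close>; the coefficient of \<open>s\<close> in \<open>C\<close> is
  nonzero because the roots are distinct, so neither \<open>C\<close> nor \<open>(-B + C) / 2\<close> lies in \<open>K\<close>.
  Conversely, if \<open>C = q s\<close> and \<open>(-B + C) / 2 = (x + y s)^3\<close>, then taking norms gives
  \<open>(3 (x^2 + 3 y^2))^3 = (-A)^3\<close>, and the cubes can be cancelled because \<open>K\<close> has no
  nontrivial cube root of unity.
\<close>

section \<open>Small characteristics, Vieta relations and cube roots of unity\<close>

lemma of_nat_prime_neq_0:
  assumes "prime p" "CHAR('a :: field) \<noteq> p"
  shows "(of_nat p :: 'a) \<noteq> 0"
proof
  assume "(of_nat p :: 'a) = 0"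
  hence "CHAR('a) dvd p" by (simp add: of_nat_eq_0_iff_char_dvd)
  moreover have "CHAR('a) \<noteq> 1" by simp
  ultimately show False using assms prime_nat_iff by blast
qed

text \<open>The degree forces a root set of size three, and comparing coefficients turns the
  factorization into the Vieta relations. Distinctness stays explicit because the theorem needs it
  in both directions.\<close>

lemma splits_completely_depressed_cubic_iff:
  fixes A B :: "'a :: field"
  shows "splits_completely [:B, A, 0, 1:] \<longleftrightarrow>
    (\<exists>a b c. distinct [a, b, c] \<and> a + b + c = 0 \<and> a * b + a * c + b * c = A \<and> a * b * c = - B)"
proof
  assume "splits_completely [:B, A, 0, 1:]"
  then obtain S where S: "finite S" "[:B, A, 0, 1:] = (\<Prod>a\<in>S. [:- a, 1:])"
    by (auto simp: splits_completely_def)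
  have "degree [:B, A, 0, 1:] = card S"
    using S(1) unfolding S(2) by (subst degree_prod_eq_sum_degree) auto
  hence "card S = 3" by simp
  then obtain a b c where abc: "S = {a, b, c}" "a \<noteq> b" "a \<noteq> c" "b \<noteq> c"
    by (auto simp: card_3_iff)
  have "[:B, A, 0, 1:] = [:- a, 1:] * [:- b, 1:] * [:- c, 1:]"
    using S(2) abc by (simp add: mult.assoc del: mult_pCons_left mult_pCons_right)
  hence "a + b + c = 0" "a * b + a * c + b * c = A" "a * b * c = - B"
    by (auto simp: algebra_simps add_eq_0_iff)
  thus "\<exists>a b c. distinct [a, b, c] \<and> a + b + c = 0 \<and> a * b + a * c + b * c = A \<and> a * b * c = - B"
    using abc by auto
next
  assume "\<exists>a b c. distinct [a, b, c] \<and> a + b + c = 0 \<and> a * b + a * c + b * c = A \<and> a * b * c = - B"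
  then obtain a b c where abc: "distinct [a, b, c]" "a + b + c = 0"
    "a * b + a * c + b * c = A" "a * b * c = - B"
    by blast
  have B: "B = - (a * b * c)" and c: "c = - a - b"
    using abc(2,4) by (simp_all add: eq_neg_iff_add_eq_0 algebra_simps)
  have "[:B, A, 0, 1:] = [:- a, 1:] * [:- b, 1:] * [:- c, 1:]"
    unfolding B abc(3)[symmetric] c by (simp add: algebra_simps)
  also have "\<dots> = (\<Prod>x\<in>{a, b, c}. [:- x, 1:])"
    using abc(1) by (simp add: mult.assoc del: mult_pCons_left mult_pCons_right)
  finally have prod: "[:B, A, 0, 1:] = (\<Prod>x\<in>{a, b, c}. [:- x, 1:])" .
  thus "splits_completely [:B, A, 0, 1:]"
    unfolding splits_completely_def by (intro exI[of _ "{a, b, c}"]) (simp flip: prod)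
qed

lemma primitive_cube_root_of_unity_quadratic:
  fixes \<zeta> :: "'b :: field"
  assumes "primitive_root_of_unity 3 \<zeta>"
  shows "\<zeta> ^ 2 = - 1 - \<zeta>"
proof -
  have "\<zeta> ^ 3 = 1" "\<zeta> ^ 1 \<noteq> 1"
    using assms unfolding primitive_root_of_unity_def by auto
  hence "(\<zeta> - 1) * (\<zeta> ^ 2 + \<zeta> + 1) = 0" "\<zeta> \<noteq> 1"
    by (simp_all add: algebra_simps power2_eq_square power3_eq_cube)
  hence "\<zeta> ^ 2 + \<zeta> + 1 = 0" by simp
  thus ?thesis by algebra
qed

section \<open>The base field inside its closure, and quadratic extensions of it\<close>

context field_algebraic_closure
begin

lemma emb_zero: "\<iota> 0 = 0"
  using emb_add[of 0 0] by (metis add.right_neutral add_left_cancel)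

lemma emb_minus: "\<iota> (- x) = - \<iota> x"
  using emb_add[of x "- x"] by (simp add: emb_zero eq_neg_iff_add_eq_0 add.commute)

lemma emb_diff: "\<iota> (x - y) = \<iota> x - \<iota> y"
  using emb_add[of x "- y"] by (simp add: emb_minus)

lemma emb_power: "\<iota> (x ^ n) = \<iota> x ^ n"
  by (induction n) (simp_all add: emb_one emb_mult)

lemma emb_of_nat: "\<iota> (of_nat n) = of_nat n"
  by (induction n) (simp_all add: emb_zero emb_one emb_add)

lemma emb_numeral: "\<iota> (numeral n) = numeral n"
  using emb_of_nat[of "numeral n"] by simp

lemma emb_inverse: "\<iota> (inverse x) = inverse (\<iota> x)"
proof (cases "x = 0")
  case False
  hence "\<iota> x * \<iota> (inverse x) = 1"
    by (simp add: emb_one flip: emb_mult)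
  thus ?thesis by (rule inverse_unique[symmetric])
qed (simp add: emb_zero)

lemma emb_divide: "\<iota> (x / y) = \<iota> x / \<iota> y"
  by (simp add: divide_inverse emb_mult emb_inverse)

lemmas emb_simps =
  emb_zero emb_one emb_add emb_minus emb_diff emb_mult emb_power emb_numeral emb_divide

lemma emb_eq_iff: "\<iota> x = \<iota> y \<longleftrightarrow> x = y"
proof
  assume eq: "\<iota> x = \<iota> y"
  show "x = y"
  proof (rule ccontr)
    assume "x \<noteq> y"
    hence "\<iota> ((x - y) * inverse (x - y)) = 1" by (simp add: emb_one)
    thus False using eq by (simp add: emb_mult emb_diff)
  qed
qed simp

lemma emb_eq_0_iff: "\<iota> x = 0 \<longleftrightarrow> x = 0"
  using emb_eq_iff[of x 0] by (simp add: emb_zero)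

lemma square_in_range_iff: "square_in (range \<iota>) (\<iota> x) \<longleftrightarrow> (\<exists>y. x = y ^ 2)"
  by (auto simp: square_in_def emb_eq_iff simp flip: emb_power)

text \<open>If \<open>a \<noteq> b\<close>, then \<open>a / b\<close> is a nontrivial cube root of
  unity in the base field. The only such roots are \<open>\<zeta>\<close> and
  \<open>- 1 - \<zeta>\<close>, so \<open>\<zeta>\<close> would lie in the base field too.\<close>

lemma cube_inject:
  assumes \<zeta>: "primitive_root_of_unity 3 \<zeta>" "\<zeta> \<notin> range \<iota>"
    and eq: "(a :: 'a) ^ 3 = b ^ 3"
  shows "a = b"
proof (rule ccontr)
  assume "a \<noteq> b"
  with eq have b: "b \<noteq> 0" by auto
  define t where "t = a / b"
  have "t ^ 3 = 1" "t \<noteq> 1"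
    using eq b \<open>a \<noteq> b\<close> by (auto simp: t_def power_divide)
  hence "(t - 1) * (t ^ 2 + t + 1) = 0" "t \<noteq> 1"
    by (simp_all add: algebra_simps power2_eq_square power3_eq_cube)
  hence "\<iota> (t ^ 2 + t + 1) = 0" by (simp add: emb_zero)
  hence "(\<iota> t - \<zeta>) * (\<iota> t + 1 + \<zeta>) = 0"
    using primitive_cube_root_of_unity_quadratic[OF \<zeta>(1)] unfolding emb_simps by algebra
  hence "\<zeta> = \<iota> t \<or> \<zeta> = \<iota> (- 1 - t)"
    unfolding emb_simps by algebra
  thus False using \<zeta>(2) by blast
qed

text \<open>Two different coefficients of \<open>s\<close> would allow solving for \<open>s\<close>
  in the base field. This is what splits an equation in the extension into two equations in the base
  field.\<close>

lemma quadratic_coeffs_unique: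
  assumes "s \<notin> range \<iota>" "\<iota> x + \<iota> y * s = \<iota> x' + \<iota> y' * s"
  shows "x = x'" "y = y'"
proof -
  have "y = y'"
  proof (rule ccontr)
    assume "y \<noteq> y'"
    hence "\<iota> y - \<iota> y' \<noteq> 0" by (simp add: emb_eq_iff)
    moreover have "(\<iota> y - \<iota> y') * s = \<iota> x' - \<iota> x"
      using assms(2) by algebra
    ultimately have "s = \<iota> ((x' - x) / (y - y'))"
      by (simp add: emb_simps field_simps)
    thus False using assms(1) by blast
  qed
  thus "y = y'" "x = x'" using assms(2) by (simp_all add: emb_eq_iff)
qed

lemma is_subfield_quadratic:
  assumes "s \<notin> range \<iota>" "s ^ 2 = \<iota> d"
  shows "is_subfield {\<iota> x + \<iota> y * s | x y. True}" (is "is_subfield ?E")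
proof -
  have I: "\<iota> x + \<iota> y * s \<in> ?E" for x y by blast
  have "1 \<in> ?E" using I[of 1 0] by (simp add: emb_simps)
  moreover have "u - v \<in> ?E \<and> u * v \<in> ?E" if "u \<in> ?E" "v \<in> ?E" for u v
  proof -
    from that obtain x y x' y' where uv: "u = \<iota> x + \<iota> y * s" "v = \<iota> x' + \<iota> y' * s"
      by blast
    have "u - v = \<iota> (x - x') + \<iota> (y - y') * s"
      unfolding uv emb_simps by algebra
    moreover have "u * v = \<iota> (x * x' + d * y * y') + \<iota> (x * y' + y * x') * s"
      unfolding uv emb_simps assms(2)[symmetric] by algebra
    ultimately show ?thesis by (simp only: I)
  qed
  moreover have "inverse u \<in> ?E" if "u \<in> ?E" for u
  proof (cases "u = 0")
    case True
    thus ?thesis using I[of 0 0] by (simp add: emb_simps)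
  next
    case False
    from that obtain x y where u: "u = \<iota> x + \<iota> y * s" by blast
    \<comment> \<open>The norm of \<open>u\<close>: the inverse is the conjugate divided by
      \<open>n\<close>. The conjugate, and hence \<open>n\<close>, is nonzero because its vanishing
      would force \<open>x = y = 0\<close>.\<close>
    define n where "n = x ^ 2 - d * y ^ 2"
    have norm: "u * (\<iota> x - \<iota> y * s) = \<iota> n"
      unfolding u n_def emb_simps assms(2)[symmetric] by algebra
    have "\<iota> x - \<iota> y * s \<noteq> 0"
    proof
      assume "\<iota> x - \<iota> y * s = 0"
      hence "x = 0" "- y = 0"
        using quadratic_coeffs_unique[OF assms(1), of x "- y" 0 0] by (simp_all add: emb_simps)
      thus False using False by (simp add: u emb_simps)
    qed
    hence "\<iota> n \<noteq> 0" using norm False by (metis mult_eq_0_iff)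
    hence "u * ((\<iota> x - \<iota> y * s) / \<iota> n) = 1" using norm by simp
    hence "inverse u = (\<iota> x - \<iota> y * s) / \<iota> n" by (rule inverse_unique)
    also have "\<dots> = \<iota> (x / n) + \<iota> (- y / n) * s"
      by (simp add: emb_simps diff_divide_distrib)
    finally show ?thesis by (simp only: I)
  qed
  ultimately show ?thesis unfolding is_subfield_def by blast
qed

text \<open>As \<open>l \<noteq> 0\<close>, \<open>\<zeta>\<close> and \<open>s\<close> are rational
  expressions of each other, so they generate the same field. Coordinates in \<open>s\<close> are
  preferred because \<open>s ^ 2\<close> lies in the base field.\<close>

lemma adjoin_quadratic:
  assumes "s \<notin> range \<iota>" "s ^ 2 = \<iota> d"
    and "\<zeta> = \<iota> k + \<iota> l * s" "l \<noteq> 0"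
  shows "adjoin (range \<iota>) \<zeta> = {\<iota> x + \<iota> y * s | x y. True}" (is "_ = ?E")
proof
  have "\<iota> x \<in> ?E" for x
    by (rule CollectI, rule exI[of _ x], rule exI[of _ 0]) (simp add: emb_zero)
  thus "adjoin (range \<iota>) \<zeta> \<subseteq> ?E"
    unfolding adjoin_def using is_subfield_quadratic[OF assms(1,2)] assms(3) by blast
  show "?E \<subseteq> adjoin (range \<iota>) \<zeta>"
    unfolding adjoin_def
  proof (intro Inter_greatest subsetI, clarsimp)
    fix E x y
    assume E: "is_subfield E" "range \<iota> \<subseteq> E" "\<zeta> \<in> E"
    \<comment> \<open>From \<open>s = (\<zeta> - k) / l\<close>; a difference is used because
      \<open>is_subfield\<close> is phrased with differences.\<close>
    define x' where "x' = y * k / l - x"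
    have "\<iota> x + \<iota> y * s = \<iota> (y / l) * \<zeta> - \<iota> x'"
      using assms(4) by (simp add: assms(3) x'_def emb_simps emb_eq_0_iff field_simps)
    also have "\<dots> \<in> E"
      using E unfolding is_subfield_def by blast
    finally show "\<iota> x + \<iota> y * s \<in> E" .
  qed
qed

end

section \<open>The splitting criterion for the depressed cubic\<close>

theorem theorem8:
  fixes \<iota> :: "'a :: field \<Rightarrow> 'b :: alg_closed_field"
    and A B \<Delta> :: 'a and \<zeta> C :: 'b and f :: "'a poly"
  assumes "CHAR('a) \<noteq> 2" and "CHAR('a) \<noteq> 3"
    and "field_algebraic_closure \<iota>"
    and "primitive_root_of_unity 3 \<zeta>" and "\<zeta> \<notin> range \<iota>"
    and "f = [:B, A, 0, 1:]" and "B \<noteq> 0"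
    and "\<Delta> = B ^ 2 + 4 * A ^ 3 / 27"
    and "A = 0 \<Longrightarrow> C = - \<iota> B"
    and "A \<noteq> 0 \<Longrightarrow> C ^ 2 = \<iota> \<Delta>"
  shows "splits_completely f \<longleftrightarrow>
    (square_in (adjoin (range \<iota>) \<zeta>) (\<iota> \<Delta>) \<and> \<not> square_in (range \<iota>) (\<iota> \<Delta>)) \<and>
    (cube_in (adjoin (range \<iota>) \<zeta>) ((- \<iota> B + C) / 2) \<and> \<not> cube_in (range \<iota>) ((- \<iota> B + C) / 2))"
proof -
  interpret field_algebraic_closure \<iota> by fact
  have two: "(2 :: 'a) \<noteq> 0" and three: "(3 :: 'a) \<noteq> 0"
    using of_nat_prime_neq_0[OF _ assms(1)] of_nat_prime_neq_0[OF _ assms(2)] by simp_all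
  have two': "(2 :: 'b) \<noteq> 0"
    using two emb_eq_0_iff[of 2] by (simp add: emb_numeral)
  have "(27 :: 'a) = 3 ^ 3" by simp
  hence tw: "(27 :: 'a) \<noteq> 0" using three by (metis power_not_zero)
  have \<Delta>27: "27 * \<Delta> = 27 * B ^ 2 + 4 * A ^ 3"
    using tw by (simp add: assms(8) field_simps)
  have \<zeta>2: "\<zeta> ^ 2 = - 1 - \<zeta>"
    using assms(4) by (rule primitive_cube_root_of_unity_quadratic)
  define s where "s = 2 * \<zeta> + 1"
  have s2: "s ^ 2 = - 3" unfolding s_def using \<zeta>2 by algebra
  have \<zeta>_s: "\<zeta> = \<iota> (- 1 / 2) + \<iota> (1 / 2) * s"
    using two' by (simp add: s_def emb_simps distrib_left)
  have s: "s \<notin> range \<iota>"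
  proof
    assume "s \<in> range \<iota>"
    then obtain t where "s = \<iota> t" by blast
    hence "\<zeta> = \<iota> (- 1 / 2 + 1 / 2 * t)" using \<zeta>_s by (simp only: emb_add emb_mult)
    thus False using assms(5) by blast
  qed
  have adj: "adjoin (range \<iota>) \<zeta> = {\<iota> x + \<iota> y * s | x y. True}"
    using s _ \<zeta>_s by (rule adjoin_quadratic[where d = "- 3"]) (use s2 two in \<open>simp_all add: emb_simps\<close>)
  have s_coeffs: "x = x' \<and> y = y'" if "\<iota> x + \<iota> y * s = \<iota> x' + \<iota> y' * s" for x y x' y'
    using quadratic_coeffs_unique[OF s that] by blast

  show ?thesis
  proof
    assume "splits_completely f"
    then obtain a b c where d: "a \<noteq> b" "a \<noteq> c" "b \<noteq> c"
      and abc: "a + b + c = 0" "a * b + a * c + b * c = A" "a * b * c = - B"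
      unfolding assms(6) splits_completely_depressed_cubic_iff by auto
    \<comment> \<open>For \<open>A = 0\<close> all three roots would have the same cube
      \<open>- B\<close>, hence coincide.\<close>
    have "A \<noteq> 0"
    proof
      assume "A = 0"
      hence "a ^ 3 = b ^ 3" using abc by algebra
      thus False using cube_inject[OF assms(4,5)] d by blast
    qed
    hence C2: "C ^ 2 = \<iota> \<Delta>" by (rule assms(10))
    define x where "x = a / 2"
    define y0 where "y0 = (b - c) / 6"
    \<comment> \<open>This is the coefficient of \<open>s\<close> in
      \<open>2 * (x + y0 * s) ^ 3\<close>. Moreover
      \<open>9 * e = (a - b) * (a - c) * (b - c)\<close>, so distinct roots make \<open>e\<close>
      nonzero.\<close>
    define e where "e = 6 * y0 * (x ^ 2 - y0 ^ 2)"
    have "(6 :: 'a) = 2 * 3" by simp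
    hence six: "(6 :: 'a) \<noteq> 0" using two three by (metis mult_eq_0_iff)
    have a: "a = 2 * x" and "b - c = 6 * y0"
      using two six by (simp_all add: x_def y0_def)
    moreover from this abc(1) have "2 * b = 2 * (- x + 3 * y0)" "2 * c = 2 * (- x - 3 * y0)"
      by algebra+
    ultimately have b: "b = - x + 3 * y0" and c: "c = - x - 3 * y0"
      using mult_left_cancel[OF two] by blast+
    have "y0 \<noteq> 0" "y0 \<noteq> x" "y0 \<noteq> - x" using d unfolding a b c by auto
    hence e0: "e \<noteq> 0"
      using six by (auto simp: e_def power2_eq_iff)
    have B: "- B = 2 * (x ^ 3 - 9 * x * y0 ^ 2)" and A: "A = - 3 * (x ^ 2 + 3 * y0 ^ 2)"
      using abc unfolding a b c by algebra+
    have "27 * \<Delta> = 27 * (- B) ^ 2 + 4 * A ^ 3" using \<Delta>27 by simp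
    also have "\<dots> = 27 * (- 3 * e ^ 2)" unfolding A B e_def by algebra
    finally have "27 * \<Delta> = 27 * (- 3 * e ^ 2)" .
    hence e\<Delta>: "\<Delta> = - 3 * e ^ 2" using mult_left_cancel[OF tw] by blast
    have es: "\<iota> \<Delta> = (\<iota> e * s) ^ 2" using s2 unfolding e\<Delta> emb_simps by algebra
    have "C = \<iota> e * s \<or> C = \<iota> (- e) * s"
      using C2 unfolding es power2_eq_iff by (simp add: emb_minus)
    \<comment> \<open>The sign of \<open>C\<close> is not ours to choose. Exchanging
      \<open>b\<close> and \<open>c\<close> negates \<open>y0\<close> and with it \<open>e\<close>,
      so one sign of \<open>y\<close> fits the given \<open>C\<close>, while \<open>A\<close> and
      \<open>B\<close> involve only \<open>y0 ^ 2\<close>.\<close>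
    hence "\<exists>y\<in>{y0, - y0}. C = \<iota> (6 * y * (x ^ 2 - y ^ 2)) * s"
      by (simp add: e_def)
    then obtain y where y: "y = y0 \<or> y = - y0"
      and C: "C = \<iota> (6 * y * (x ^ 2 - y ^ 2)) * s"
      by blast
    define q where "q = 6 * y * (x ^ 2 - y ^ 2)"
    have q: "q \<noteq> 0" "C = \<iota> q * s" using y e0 C by (auto simp: q_def e_def)
    have B: "- B = 2 * (x ^ 3 - 9 * x * y ^ 2)" using y B by auto
    have "\<iota> e * s = \<iota> 0 + \<iota> e * s" by (simp add: emb_zero)
    hence "square_in (adjoin (range \<iota>) \<zeta>) (\<iota> \<Delta>)"
      unfolding square_in_def adj using es by blast
    moreover have "\<not> square_in (range \<iota>) (\<iota> \<Delta>)"
    proof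
      assume "square_in (range \<iota>) (\<iota> \<Delta>)"
      then obtain y where "\<iota> \<Delta> = \<iota> y ^ 2" by (auto simp: square_in_def)
      hence "\<iota> y = \<iota> e * s \<or> \<iota> y = - (\<iota> e * s)" unfolding es by (metis power2_eq_iff)
      hence "\<iota> y + \<iota> 0 * s = \<iota> 0 + \<iota> e * s \<or> \<iota> y + \<iota> 0 * s = \<iota> 0 + \<iota> (- e) * s"
        by (simp add: emb_zero emb_minus)
      thus False using s_coeffs[of y 0 0 e] s_coeffs[of y 0 0 "- e"] e0 by auto
    qed
    \<comment> \<open>The coefficient \<open>q / 2\<close> of \<open>s\<close> is nonzero, so the
      element does not even lie in the base field.\<close>
    moreover have "\<not> cube_in (range \<iota>) ((- \<iota> B + C) / 2)"
    proof
      assume "cube_in (range \<iota>) ((- \<iota> B + C) / 2)"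
      then obtain y where "(- \<iota> B + C) / 2 = \<iota> y ^ 3" by (auto simp: cube_in_def)
      hence "\<iota> (- B) + \<iota> q * s = \<iota> (2 * y ^ 3) + \<iota> 0 * s"
        using two' by (simp add: q emb_simps divide_eq_eq mult.commute)
      thus False using s_coeffs q by blast
    qed
    moreover have "cube_in (adjoin (range \<iota>) \<zeta>) ((- \<iota> B + C) / 2)"
    proof -
      have "\<iota> (- B) + C = 2 * (\<iota> x + \<iota> y * s) ^ 3"
        using s2 unfolding q(2) q_def B emb_simps by algebra
      hence "(- \<iota> B + C) / 2 = (\<iota> x + \<iota> y * s) ^ 3"
        using two' by (simp add: emb_minus)
      thus ?thesis unfolding cube_in_def adj by blast
    qed
    ultimately show "(square_in (adjoin (range \<iota>) \<zeta>) (\<iota> \<Delta>) \<and> \<not> square_in (range \<iota>) (\<iota> \<Delta>)) \<and>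
      (cube_in (adjoin (range \<iota>) \<zeta>) ((- \<iota> B + C) / 2) \<and> \<not> cube_in (range \<iota>) ((- \<iota> B + C) / 2))"
      by blast
  next
    assume "(square_in (adjoin (range \<iota>) \<zeta>) (\<iota> \<Delta>) \<and> \<not> square_in (range \<iota>) (\<iota> \<Delta>)) \<and>
      (cube_in (adjoin (range \<iota>) \<zeta>) ((- \<iota> B + C) / 2) \<and> \<not> cube_in (range \<iota>) ((- \<iota> B + C) / 2))"
    hence sq: "square_in (adjoin (range \<iota>) \<zeta>) (\<iota> \<Delta>)" "\<not> square_in (range \<iota>) (\<iota> \<Delta>)"
      and cu: "cube_in (adjoin (range \<iota>) \<zeta>) ((- \<iota> B + C) / 2)"
      by blast+
    have nsq: "\<Delta> \<noteq> y ^ 2" for y using sq(2) by (simp add: square_in_range_iff)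
    \<comment> \<open>For \<open>A = 0\<close>, \<open>\<Delta>\<close> would be the square of
      \<open>B\<close>.\<close>
    have "A \<noteq> 0" using nsq[of B] by (auto simp: assms(8))
    hence C2: "C ^ 2 = \<iota> \<Delta>" by (rule assms(10))
    obtain p q0 where p: "\<iota> \<Delta> = (\<iota> p + \<iota> q0 * s) ^ 2"
      using sq(1) unfolding square_in_def adj by blast
    have "\<iota> (p ^ 2 - 3 * q0 ^ 2) + \<iota> (2 * p * q0) * s = \<iota> \<Delta> + \<iota> 0 * s"
      using p s2 unfolding emb_simps by algebra
    hence pq: "\<Delta> = p ^ 2 - 3 * q0 ^ 2" "2 * p * q0 = 0" using s_coeffs by blast+
    \<comment> \<open>The alternative \<open>q0 = 0\<close> would make
      \<open>\<Delta> = p ^ 2\<close> a square in the base field.\<close>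
    have "p = 0" using pq two nsq[of p] by auto
    have "C = \<iota> q0 * s \<or> C = \<iota> (- q0) * s"
      using C2 unfolding p \<open>p = 0\<close> power2_eq_iff by (simp add: emb_zero emb_minus)
    then obtain q where C: "C = \<iota> q * s" and "q = q0 \<or> q = - q0"
      by blast
    hence q: "\<Delta> = - 3 * q ^ 2" using pq(1) \<open>p = 0\<close> by auto
    have q0: "q \<noteq> 0" using nsq[of 0] q by auto
    obtain x y where "(- \<iota> B + C) / 2 = (\<iota> x + \<iota> y * s) ^ 3"
      using cu unfolding cube_in_def adj by blast
    hence "- \<iota> B + C = 2 * (\<iota> x + \<iota> y * s) ^ 3" using two' by (simp add: divide_eq_eq mult.commute)
    hence "\<iota> (- B) + \<iota> q * s =
      \<iota> (2 * (x ^ 3 - 9 * x * y ^ 2)) + \<iota> (6 * y * (x ^ 2 - y ^ 2)) * s"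
      using s2 unfolding C emb_simps by algebra
    hence B: "- B = 2 * (x ^ 3 - 9 * x * y ^ 2)" and qxy: "q = 6 * y * (x ^ 2 - y ^ 2)"
      using s_coeffs by blast+
    \<comment> \<open>Taking norms of \<open>- B + q * s = 2 * (x + y * s) ^ 3\<close> gives
      \<open>B ^ 2 + 3 * q ^ 2 = 4 * (x ^ 2 + 3 * y ^ 2) ^ 3\<close>, and the left side is
      \<open>B ^ 2 - \<Delta>\<close>.\<close>
    have "(- A) ^ 3 * 4 = 27 * (- B) ^ 2 - 27 * \<Delta>"
      using \<Delta>27 by (simp add: algebra_simps)
    also have "\<dots> = (3 * (x ^ 2 + 3 * y ^ 2)) ^ 3 * 4"
      unfolding B q qxy by algebra
    finally have "(- A) ^ 3 * 4 = (3 * (x ^ 2 + 3 * y ^ 2)) ^ 3 * 4" .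
    moreover have "(4 :: 'a) \<noteq> 0"
      using two by (metis mult_2 mult_eq_0_iff numeral_Bit0)
    ultimately have "(- A) ^ 3 = (3 * (x ^ 2 + 3 * y ^ 2)) ^ 3"
      using mult_right_cancel by blast
    hence A: "- A = 3 * (x ^ 2 + 3 * y ^ 2)" by (rule cube_inject[OF assms(4,5)])
    \<comment> \<open>Up to nonzero constants, the factors of \<open>q\<close> are the differences
      of the candidate roots \<open>2 * x\<close> and \<open>- x \<plusminus> 3 * y\<close>, so
      \<open>q \<noteq> 0\<close> makes these distinct.\<close>
    have "q = 6 * y * ((x + y) * (x - y))" using qxy by algebra
    hence "3 * (x + y) \<noteq> 0" "3 * (x - y) \<noteq> 0" "6 * y \<noteq> 0"
      using q0 three by (auto simp del: distrib_left_numeral right_diff_distrib_numeral)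
    moreover have "3 * (x + y) = 2 * x - (- x - 3 * y)" "3 * (x - y) = 2 * x - (- x + 3 * y)"
      "6 * y = (- x + 3 * y) - (- x - 3 * y)"
      by algebra+
    ultimately have "distinct [2 * x, - x + 3 * y, - x - 3 * y]"
      by (metis distinct_length_2_or_more distinct_singleton right_minus_eq)
    moreover have "2 * x + (- x + 3 * y) + (- x - 3 * y) = 0" by simp
    moreover have "2 * x * (- x + 3 * y) + 2 * x * (- x - 3 * y) + (- x + 3 * y) * (- x - 3 * y) = A"
      using A by algebra
    moreover have "2 * x * (- x + 3 * y) * (- x - 3 * y) = - B"
      unfolding B by algebra
    ultimately show "splits_completely f"
      unfolding assms(6) splits_completely_depressed_cubic_iff by (intro exI conjI)
  qed
qed

end
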